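(* Let $n\ge 1$ be an integer, let $D\ge 0$ be a real number, and let $G$ be the complete graph on the vertex set $\{1,\dots,n\}$. Among all load distributions $\vec m=(m_1,\dots,m_n)$ on $G$ with total load $\sum_{i=1}^n m_i=D$, the flow $\mathcal F(\vec m)$ is maximum when $m_i=D/n$ for all $i=1,\dots,n$, and the value of this maximum flow is $$\mathcal F=\left(\frac{D}{n}\right)^2\binom{n}{2}.$$
   Context: A load distribution on a finite graph $G=(V,E)$ is a vector $\vec m=(m_v)_{v\in V}$ of real numbers $m_v\ge 0$; its total load is $\sum_{v\in V}m_v$. The flow of $\vec m$ is $$\mathcal F(\vec m)=\sum_{\{u,v\}\in E} m_u m_v,$$ where each (undirected) edge is counted once. *)

theory Defs
  imports Complex_Main
begin

text \<open>An undirected edge joining u and v is the two-element set {u, v}.\<close>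

locale finite_graph =
  fixes V :: "'a set" and E :: "'a set set"
  assumes finite_vertices: "finite V"
    and edges: "E \<subseteq> {{u, v} | u v. u \<in> V \<and> v \<in> V \<and> u \<noteq> v}"

text \<open>The values of a load distribution outside V are unconstrained and enter neither its total
  load nor its flow.\<close>

definition load_distribution :: "'a set \<Rightarrow> ('a \<Rightarrow> real) \<Rightarrow> bool" where
  "load_distribution V m \<longleftrightarrow> (\<forall>v\<in>V. 0 \<le> m v)"

definition total_load :: "'a set \<Rightarrow> ('a \<Rightarrow> real) \<Rightarrow> real" where
  "total_load V m = (\<Sum>v\<in>V. m v)"

text \<open>The inner product runs over the two endpoints of the edge e, so every undirected edge
  {u, v} contributes m u * m v exactly once.\<close>

definition flow :: "'a set set \<Rightarrow> ('a \<Rightarrow> real) \<Rightarrow> real" where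
  "flow E m = (\<Sum>e\<in>E. \<Prod>v\<in>e. m v)"

definition complete_edges :: "'a set \<Rightarrow> 'a set set" where
  "complete_edges V = {{u, v} | u v. u \<in> V \<and> v \<in> V \<and> u \<noteq> v}"

lemma prod_edge: "u \<noteq> v \<Longrightarrow> (\<Prod>w\<in>{u, v}. m w) = m u * (m v :: real)"
  by simp

lemma finite_graph_complete: "finite V \<Longrightarrow> finite_graph V (complete_edges V)"
  by (simp add: finite_graph_def complete_edges_def)

end

theory Submission
  imports Defs
begin

text \<open>Since twice the flow on a complete graph is the square of the total load minus the sum of the
  squared loads, maximising the flow at fixed total load D means minimising the sum of squares,
  which by expanding the squared deviations from D/n is smallest at the uniform distribution.\<close>

lemma complete_edges_insert:
  assumes "x \<notin> V"
  shows "complete_edges (insert x V) = complete_edges V \<union> (\<lambda>v. {x, v}) ` V"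
  using assms unfolding complete_edges_def by (auto simp: insert_commute)

lemma finite_complete_edges: "finite V \<Longrightarrow> finite (complete_edges V)"
  by (rule finite_subset[of _ "Pow V"]) (auto simp: complete_edges_def)

text \<open>The edges gained with \<open>x\<close> join it to each \<open>v\<close> in
  \<open>V\<close> exactly once, so their contributions \<open>m x * m v\<close> factor.\<close>

lemma flow_complete_edges_insert:
  assumes "finite V" "x \<notin> V"
  shows "flow (complete_edges (insert x V)) m = flow (complete_edges V) m + m x * total_load V m"
proof -
  have disj: "complete_edges V \<inter> (\<lambda>v. {x, v}) ` V = {}"
    using assms(2) by (auto simp: complete_edges_def doubleton_eq_iff)
  have inj: "inj_on (\<lambda>v. {x, v}) V"
    using assms(2) by (auto simp: inj_on_def doubleton_eq_iff)
  have "(\<Sum>v\<in>V. \<Prod>w\<in>{x, v}. m w) = (\<Sum>v\<in>V. m x * m v)"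
    using assms(2) by (intro sum.cong refl prod_edge) auto
  then show ?thesis
    using assms disj inj unfolding flow_def total_load_def complete_edges_insert[OF assms(2)]
    by (simp add: sum.union_disjoint finite_complete_edges sum.reindex sum_distrib_left)
qed

text \<open>Induction on \<open>V\<close>: a new vertex \<open>x\<close> raises the squared load by
  \<open>2 * m x * total_load V m + (m x)\<^sup>2\<close>; the first term is twice the gain in flow,
  the second cancels against the sum of squares.\<close>

lemma two_flow_complete_edges:
  assumes "finite V"
  shows "2 * flow (complete_edges V) m = (total_load V m)\<^sup>2 - (\<Sum>v\<in>V. (m v)\<^sup>2)"
  using assms
proof induction
  case empty
  show ?case by (simp add: flow_def complete_edges_def total_load_def)
next
  case (insert x V)
  have "total_load (insert x V) m = m x + total_load V m"
    using insert.hyps by (simp add: total_load_def)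
  then show ?case
    using insert by (simp add: flow_complete_edges_insert power2_eq_square algebra_simps)
qed

lemma total_load_squared_le:
  assumes "finite V"
  shows "(total_load V m)\<^sup>2 / real (card V) \<le> (\<Sum>v\<in>V. (m v)\<^sup>2)"
\<comment> \<open>For empty \<open>V\<close> both sides are 0, as division by zero gives 0.\<close>
proof (cases "V = {}")
  case False
  \<comment> \<open>The mean load, about which the squared deviations are expanded.\<close>
  define c where "c = total_load V m / real (card V)"
  have card: "real (card V) > 0"
    using assms False by (simp add: card_gt_0_iff)
  have "0 \<le> (\<Sum>v\<in>V. (m v - c)\<^sup>2)"
    by (simp add: sum_nonneg)
  also have "\<dots> = (\<Sum>v\<in>V. (m v)\<^sup>2) - 2 * c * total_load V m + real (card V) * c\<^sup>2"
    by (simp add: power2_diff sum.distrib sum_subtractf total_load_def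
        flip: sum_distrib_left sum_distrib_right)
  \<comment> \<open>Since \<open>real (card V) * c\<close> is the total load, the last two terms
    combine to \<open>- c * total_load V m\<close>.\<close>
  also have "\<dots> = (\<Sum>v\<in>V. (m v)\<^sup>2) - (total_load V m)\<^sup>2 / real (card V)"
    using card by (simp add: c_def power2_eq_square field_simps)
  finally show ?thesis by simp
qed simp

lemma flow_complete_edges_const:
  assumes "finite V"
  shows "flow (complete_edges V) (\<lambda>v. c) = c\<^sup>2 * real (card V choose 2)"
proof -
  have "2 * real (card V choose 2) = real (card V) * (real (card V) - 1)"
    \<comment> \<open>The case split removes the truncated predecessor in \<open>choose_two\<close>;
      at 0 both sides vanish.\<close>
    by (cases "card V") (simp_all add: choose_two real_of_nat_div algebra_simps)
  then have "2 * (c\<^sup>2 * real (card V choose 2)) = c\<^sup>2 * (real (card V) * (real (card V) - 1))"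
    by simp
  also have "\<dots> = 2 * flow (complete_edges V) (\<lambda>v. c)"
    using two_flow_complete_edges[OF assms, of "\<lambda>v. c"]
    by (simp add: total_load_def power2_eq_square algebra_simps)
  finally show ?thesis by simp
qed

theorem theorem3:
  fixes n :: nat and D :: real
  assumes "n \<ge> 1" and "D \<ge> 0"
  shows "is_arg_max (flow (complete_edges {1..n}))
           (\<lambda>m. load_distribution {1..n} m \<and> total_load {1..n} m = D) (\<lambda>i. D / real n)
       \<and> flow (complete_edges {1..n}) (\<lambda>i. D / real n) = (D / real n)\<^sup>2 * real (n choose 2)"
proof
  let ?u = "\<lambda>i::nat. D / real n"
  have feasible: "load_distribution {1..n} ?u" "total_load {1..n} ?u = D"
    using assms by (auto simp: load_distribution_def total_load_def)
  \<comment> \<open>The uniform squares sum to \<open>n * (D / n)\<^sup>2\<close>, that is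
    \<open>D\<^sup>2 / n\<close>, so equality holds in \<open>total_load_squared_le\<close>.\<close>
  have flow_u: "2 * flow (complete_edges {1..n}) ?u = D\<^sup>2 - D\<^sup>2 / real n"
    using two_flow_complete_edges[of "{1..n}" ?u] feasible(2) assms(1)
    by (simp add: power2_eq_square)
  have "flow (complete_edges {1..n}) m \<le> flow (complete_edges {1..n}) ?u"
    if "total_load {1..n} m = D" for m
    using two_flow_complete_edges[of "{1..n}" m] total_load_squared_le[of "{1..n}" m] that flow_u
    by simp
  then show "is_arg_max (flow (complete_edges {1..n}))
      (\<lambda>m. load_distribution {1..n} m \<and> total_load {1..n} m = D) ?u"
    using feasible by (auto simp: is_arg_max_def not_less)
  show "flow (complete_edges {1..n}) ?u = (D / real n)\<^sup>2 * real (n choose 2)"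
    using flow_complete_edges_const[of "{1..n}" "D / real n"] by simp
qed

end
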